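(* Let $a>1$ be real and let $n_a$ denote the smallest positive integer $k$ with $a^k\le k!$. For each integer $k\ge1$ put $T_k=e\sqrt[k]{k!}$ and let $\sigma_k$ be the smallest integer $\ell$ such that $T_k<k+\ell$ (equivalently, the largest integer $\ell$ with $k+\ell-1\le T_k$). Suppose $n\ge 3$ is an integer and $n/e<a\le (n+1)/e$. Let $m$ be the integer determined by $n+m-1\le e\sqrt[n]{n!}<n+m$. Then: (a) $2\le m=\sigma_n<n$, and the finite sequence $\sigma_{n-m},\sigma_{n-m+1},\ldots,\sigma_n$ takes exactly one or exactly two distinct values. When this sequence takes two values, let $\ell$ with $n-m\le \ell<n$ be the (unique) index such that $\sigma_{\ell+1}=\sigma_\ell+1$. (b) If the sequence takes one value, or takes two values and $\ell=n-m$, then $n_a=n-m+1$ or $n_a=n-m+2$. (c) If the sequence takes two values and $\ell=n-m+1$, then $n_a=n-m+2$. (d) If the sequence takes two values and $\ell\ge n-m+2$, then $n_a=n-m+2$ or $n_a=n-m+3$.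
   Context: $n_a$ exists for every $a>1$ since $a^k/k!\to0$. The sequence $\sigma_1,\sigma_2,\ldots$ is nondecreasing. *)

theory Defs
  imports Complex_Main
begin

definition n_fact :: "real \<Rightarrow> nat" where
  "n_fact a = (LEAST k::nat. 1 \<le> k \<and> a ^ k \<le> fact k)"

(* Only meant for k \<ge> 1: in the library, root 0 x = 0. *)
definition T :: "nat \<Rightarrow> real" where
  "T k = exp 1 * root k (fact k)"

definition sigma :: "nat \<Rightarrow> int" where
  "sigma k = (LEAST l::int. T k < of_int (int k + l))"

(* The minima in n_fact and sigma are attained, so LEAST is never unspecified. *)

lemma n_fact_exists: "\<exists>k::nat. 1 \<le> k \<and> a ^ k \<le> fact k" for a :: real
proof -
  have "(\<lambda>k. a ^ k / fact k) \<longlonglongrightarrow> 0"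
    using summable_LIMSEQ_zero[OF summable_exp[of a]] by (simp add: field_simps)
  then have "eventually (\<lambda>k. a ^ k / fact k < 1) sequentially"
    by (rule order_tendstoD) simp
  then obtain N where N: "\<And>k. k \<ge> N \<Longrightarrow> a ^ k / fact k < 1"
    by (auto simp: eventually_sequentially)
  have "a ^ Suc N / fact (Suc N) < 1" by (rule N) simp
  then have "a ^ Suc N < fact (Suc N)"
    by (subst (asm) pos_divide_less_eq) (simp_all del: fact_Suc power_Suc)
  then have "1 \<le> Suc N \<and> a ^ Suc N \<le> fact (Suc N)" by simp
  then show ?thesis by blast
qed

lemma n_fact_props:
  shows "1 \<le> n_fact a" and "a ^ n_fact a \<le> fact (n_fact a)"
    and "1 \<le> k \<Longrightarrow> a ^ k \<le> fact k \<Longrightarrow> n_fact a \<le> k"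
  using LeastI_ex[OF n_fact_exists[of a]]
  by (auto simp: n_fact_def intro!: Least_le)

lemma sigma_eq_floor: "sigma k = \<lfloor>T k\<rfloor> - int k + 1"
  unfolding sigma_def
proof (rule Least_equality)
  show "T k < of_int (int k + (\<lfloor>T k\<rfloor> - int k + 1))"
    using floor_correct[of "T k"] by simp
  fix y :: int
  assume "T k < of_int (int k + y)"
  then have "\<lfloor>T k\<rfloor> < int k + y" by (simp only: floor_less_iff)
  then show "\<lfloor>T k\<rfloor> - int k + 1 \<le> y" by simp
qed

lemma sigma_eq_iff:
  "sigma k = l \<longleftrightarrow> of_int (int k + l - 1) \<le> T k \<and> T k < of_int (int k + l)"
proof -
  have "sigma k = l \<longleftrightarrow> \<lfloor>T k\<rfloor> = int k + l - 1"
    unfolding sigma_eq_floor by auto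
  then show ?thesis by (simp add: floor_eq_iff)
qed

end

theory Submission
  imports Defs
begin

text \<open>Since \<open>a\<^sup>k \<le> k!\<close> means \<open>e a \<le> T\<^sub>k\<close>, and \<open>n < e a \<le> n + 1\<close>, the position of \<open>n\<^sub>a\<close> is read off
the values \<open>\<sigma>\<^sub>k\<close> for \<open>n - m \<le> k \<le> n\<close>. It remains to control the excess \<open>T\<^sub>k - k\<close>. From
\<open>T\<^sub>k\<^sub>+\<^sub>1\<^sup>k\<^sup>+\<^sup>1 = e (k + 1) T\<^sub>k\<^sup>k\<close> and elementary bounds for the logarithm, the excess is nondecreasing and grows
by at most \<open>1 / k\<close> in each step. Hence over the window it grows by at most \<open>m / (n - m)\<close>, which is at
most \<open>1\<close> once \<open>2 m \<le> n\<close>; this holds whenever \<open>m \<ge> 4\<close>. For \<open>m \<le> 3\<close> the bound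
\<open>\<sigma>\<^sub>k \<ge> 2\<close> alone leaves at most two values.\<close>

section \<open>Elementary bounds for \<open>ln\<close> and \<open>exp 1\<close>\<close>

text \<open>This is \<open>y \<le> sinh y\<close> at \<open>y = ln x\<close>. The bound agrees with
  \<open>ln\<close> to second order at 1, unlike the tangent \<open>x - 1\<close>.\<close>

lemma ln_le_half_diff_inverse:
  fixes x :: real
  assumes "1 \<le> x"
  shows "ln x \<le> (x - inverse x) / 2"
  using real_le_x_sinh[of "ln x"] assms by simp

text \<open>Six Taylor terms with remainder at most \<open>3 / fact 6\<close>. The tightest use is
  \<open>(exp 1 - 1)\<^sup>2 \<le> 3\<close>, the base case of \<open>T_excess_bounds\<close>: the
  square of 1.73 is 2.9929.\<close>

lemma exp_1_le_273: "exp (1::real) \<le> 273 / 100"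
proof -
  obtain t :: real where t: "\<bar>t\<bar> \<le> 1"
    and eq: "exp (1::real) = (\<Sum>i<6. 1 ^ i / fact i) + exp t / fact 6 * 1 ^ 6"
    using Maclaurin_exp_le[of 1 6] by auto
  have "exp t \<le> exp 1" using t by simp
  then have "exp t \<le> 3" using exp_le by linarith
  then show ?thesis using eq by (simp add: eval_nat_numeral)
qed

section \<open>The recursion for \<open>T\<close> and bounds for its increments\<close>

lemma T_pos: "1 \<le> k \<Longrightarrow> 0 < T k"
  by (simp add: T_def)

lemma T_power: "1 \<le> k \<Longrightarrow> T k ^ k = exp 1 ^ k * fact k"
  by (simp add: T_def power_mult_distrib)

lemma T_1: "T 1 = exp 1"
  by (simp add: T_def)

lemma T_Suc_ln:
  assumes "1 \<le> k"
  shows "real (Suc k) * ln (T (Suc k)) = 1 + ln (real k + 1) + real k * ln (T k)"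
proof -
  have "T (Suc k) ^ Suc k = exp 1 * (real k + 1) * T k ^ k"
    using assms by (simp only: T_power le_SucI) (simp add: algebra_simps)
  then have "ln (T (Suc k) ^ Suc k) = ln (exp 1 * (real k + 1) * T k ^ k)"
    by (rule arg_cong)
  moreover have "ln (T (Suc k) ^ Suc k) = real (Suc k) * ln (T (Suc k))"
    using T_pos[of "Suc k"] by (simp only: ln_realpow)
  moreover have "ln (exp 1 * (real k + 1) * T k ^ k) = 1 + ln (real k + 1) + real k * ln (T k)"
    using T_pos[OF assms] by (simp add: ln_mult ln_realpow)
  ultimately show ?thesis by simp
qed

lemma T_Suc_le_iff:
  assumes "1 \<le> k" "0 < x"
  shows "T (Suc k) \<le> x \<longleftrightarrow> 1 + ln (real k + 1) + real k * ln (T k) \<le> (real k + 1) * ln x"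
proof -
  have "T (Suc k) \<le> x \<longleftrightarrow> ln (T (Suc k)) \<le> ln x"
    using assms T_pos[of "Suc k"] by simp
  also have "\<dots> \<longleftrightarrow> real (Suc k) * ln (T (Suc k)) \<le> real (Suc k) * ln x"
    by (simp del: of_nat_Suc)
  also have "\<dots> \<longleftrightarrow> 1 + ln (real k + 1) + real k * ln (T k) \<le> (real k + 1) * ln x"
    by (simp only: T_Suc_ln[OF assms(1)]) (simp add: add.commute)
  finally show ?thesis .
qed

lemma le_T_Suc_iff:
  assumes "1 \<le> k" "0 < x"
  shows "x \<le> T (Suc k) \<longleftrightarrow> (real k + 1) * ln x \<le> 1 + ln (real k + 1) + real k * ln (T k)"
proof -
  have "x \<le> T (Suc k) \<longleftrightarrow> ln x \<le> ln (T (Suc k))"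
    using assms T_pos[of "Suc k"] by simp
  also have "\<dots> \<longleftrightarrow> real (Suc k) * ln x \<le> real (Suc k) * ln (T (Suc k))"
    by (simp del: of_nat_Suc)
  also have "\<dots> \<longleftrightarrow> (real k + 1) * ln x \<le> 1 + ln (real k + 1) + real k * ln (T k)"
    by (simp only: T_Suc_ln[OF assms(1)]) (simp add: add.commute)
  finally show ?thesis .
qed

text \<open>By \<open>exp 1 \<le> (1 + 1 / k) ^ (k + 1)\<close>, the recursion gives
  \<open>T (Suc k) \<le> (1 + 1 / k) * g\<close>, where \<open>g\<close> is the geometric mean of
  \<open>k\<close> copies of \<open>T k\<close> and one \<open>k + 1\<close>. Replacing
  \<open>g\<close> by the arithmetic mean yields exactly the right-hand side.\<close>

lemma T_Suc_le:
  assumes "1 \<le> k"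
  shows "T (Suc k) \<le> T k + 1 + 1 / real k"
proof -
  define K r where "K = real k" and "r = T k"
  define s where "s = r + 1 + 1 / K"
  have K: "1 \<le> K" and r: "0 < r" using assms T_pos by (auto simp: K_def r_def)
  have s: "0 < s" using K r by (simp add: s_def add_pos_pos)
  \<comment> \<open>The first two tangents of \<open>ln\<close> touch at the point \<open>r = K + 1\<close>, the equality case of weighted AM-GM.\<close>
  have "ln (r * (K + 1) / (K * s)) \<le> r * (K + 1) / (K * s) - 1"
    using K r s by (intro ln_le_minus_one) simp
  then have 1: "ln r + ln (K + 1) - ln K - ln s \<le> r * (K + 1) / (K * s) - 1"
    using K r s by (simp add: ln_mult ln_div)
  have "ln ((K + 1) ^ 2 / (K * s)) \<le> (K + 1) ^ 2 / (K * s) - 1"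
    using K s by (intro ln_le_minus_one) simp
  then have 2: "2 * ln (K + 1) - ln K - ln s \<le> (K + 1) ^ 2 / (K * s) - 1"
    using K s by (simp add: ln_mult ln_div ln_realpow)
  have "ln (K / (K + 1)) \<le> K / (K + 1) - 1"
    using K by (intro ln_le_minus_one) simp
  then have "ln K - ln (K + 1) \<le> - 1 / (K + 1)"
    using K by (simp add: ln_div field_simps)
  then have 3: "(K + 1) * (ln K - ln (K + 1)) \<le> - 1"
    using K by (simp add: field_simps)
  have 4: "K * (ln r + ln (K + 1) - ln K - ln s) \<le> K * (r * (K + 1) / (K * s) - 1)"
    using 1 K by (intro mult_left_mono) auto
  have Ks: "K * s = K * r + K + 1" using K by (simp add: s_def field_simps)
  have "K * (r * (K + 1) / (K * s) - 1) + ((K + 1) ^ 2 / (K * s) - 1)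
      = (K * r * (K + 1) + (K + 1) ^ 2) / (K * s) - (K + 1)"
    using K s by (simp add: field_simps)
  also have "K * r * (K + 1) + (K + 1) ^ 2 = (K + 1) * (K * s)"
    unfolding Ks by (simp add: algebra_simps power2_eq_square)
  also have "(K + 1) * (K * s) / (K * s) - (K + 1) = 0" using K s by simp
  finally have "1 + ln (K + 1) + K * ln r \<le> (K + 1) * ln s"
    using 2 3 4 by (simp add: algebra_simps)
  then show ?thesis
    using T_Suc_le_iff[OF assms s] by (simp add: K_def r_def s_def)
qed

text \<open>With \<open>u = T\<^sub>k - k\<close>, the logarithmic bounds reduce the claim to \<open>u\<^sup>2 (k + u) \<le> (k + 1) (k + 2 u)\<close>.\<close>
lemma T_Suc_ge_if_excess_small:
  assumes "1 \<le> k" and u: "1 \<le> T k - real k" and u2: "(T k - real k)\<^sup>2 \<le> real k + 2"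
  shows "T k + 1 \<le> T (Suc k)"
proof -
  define K u where "K = real k + 1" and "u = T k - real k"
  define r where "r = T k"
  have K: "2 \<le> K" and u: "1 \<le> u" and u2: "u\<^sup>2 \<le> K + 1" and r: "r = K + u - 1"
    using assms by (auto simp: K_def u_def r_def)
  have r0: "2 \<le> r" using K u r by simp
  have "ln ((r + 1) / r) \<le> ((r + 1) / r - inverse ((r + 1) / r)) / 2"
    using r0 by (intro ln_le_half_diff_inverse) simp
  then have "ln (r + 1) - ln r \<le> ((r + 1) / r - r / (r + 1)) / 2"
    using r0 by (simp add: ln_div)
  then have 1: "(K - 1) * (ln (r + 1) - ln r) \<le> (K - 1) * (((r + 1) / r - r / (r + 1)) / 2)"
    using K by (intro mult_left_mono) auto
  have "ln ((r + 1) / K) \<le> ((r + 1) / K - inverse ((r + 1) / K)) / 2"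
    using K u r by (intro ln_le_half_diff_inverse) simp
  then have 2: "ln (r + 1) - ln K \<le> ((r + 1) / K - K / (r + 1)) / 2"
    using r0 K by (simp add: ln_div)
  \<comment> \<open>The product equals \<open>K * (2 * u + K - 1) - (K + 1) * r\<close>; it remains
    to replace \<open>K + 1\<close> by the smaller \<open>u\<^sup>2\<close>.\<close>
  have "0 \<le> (u - 1) * (K - 1)" using u K by simp
  then have "(K + 1) * r \<le> K * (2 * u + K - 1)"
    by (simp add: r algebra_simps)
  moreover have "u\<^sup>2 * r \<le> (K + 1) * r"
    using u2 r0 by (intro mult_right_mono) auto
  ultimately have "u\<^sup>2 * r \<le> K * (2 * u + K - 1)" by linarith
  then have "0 \<le> (K * (2 * u + K - 1) - u\<^sup>2 * r) / (2 * K * r * (r + 1))"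
    using K r0 by (intro divide_nonneg_nonneg) auto
  also have "\<dots> = 1 - (K - 1) * (((r + 1) / r - r / (r + 1)) / 2)
      - ((r + 1) / K - K / (r + 1)) / 2"
  proof -
    have uu: "u = r + 1 - K" using r by simp
    show ?thesis using K r0 unfolding uu
      by (simp add: divide_simps) (simp add: algebra_simps power2_eq_square)
  qed
  finally have "(K - 1) * (ln (r + 1) - ln r) + (ln (r + 1) - ln K) \<le> 1"
    using 1 2 by linarith
  then have "K * ln (r + 1) \<le> 1 + ln K + (K - 1) * ln r"
    by (simp add: algebra_simps)
  then show ?thesis
    using le_T_Suc_iff[OF assms(1), of "T k + 1"] r0 by (simp add: K_def r_def)
qed

section \<open>Numerical values and the size of the excess\<close>

lemma T_2_less: "T 2 < 4"
proof (rule power_less_imp_less_base)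
  have "exp (1::real) ^ 2 \<le> (273 / 100) ^ 2"
    by (intro power_mono exp_1_le_273) simp
  then show "T 2 ^ 2 < 4 ^ 2" using T_power[of 2] by (simp add: power_divide)
qed simp

lemma T_3_less: "T 3 < 5"
proof (rule power_less_imp_less_base)
  have "exp (1::real) ^ 3 \<le> (273 / 100) ^ 3"
    by (intro power_mono exp_1_le_273) simp
  then show "T 3 ^ 3 < 5 ^ 3" using T_power[of 3] by (simp add: power_divide fact_numeral)
qed simp

text \<open>Iterating \<open>T_Suc_le\<close> from \<open>T 3 < 5\<close> adds 1/3, 1/4, 1/5, 1/6 in
  turn to the excess; the last bound is rounded up.\<close>

lemma T_small_values:
  shows "T 4 \<le> 6 + 1 / 3" "T 5 \<le> 7 + 7 / 12" "T 6 \<le> 8 + 47 / 60" "T 7 \<le> 9 + 57 / 60"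
    "T 8 < 11 + 1 / 10"
proof -
  show 4: "T 4 \<le> 6 + 1 / 3" using T_Suc_le[of 3] T_3_less by simp
  show 5: "T 5 \<le> 7 + 7 / 12" using T_Suc_le[of 4] 4 by simp
  show 6: "T 6 \<le> 8 + 47 / 60" using T_Suc_le[of 5] 5 by simp
  show 7: "T 7 \<le> 9 + 57 / 60" using T_Suc_le[of 6] 6 by simp
  show "T 8 < 11 + 1 / 10" using T_Suc_le[of 7] 7 by simp
qed

lemma excess_step:
  fixes u v x :: real
  assumes "6 \<le> x" "0 \<le> v" "v \<le> u + 1 / x" "0 \<le> u" "u\<^sup>2 \<le> x + 2"
  shows "v\<^sup>2 \<le> x + 3"
proof -
  \<comment> \<open>The slope 17/36 lies between \<open>sqrt 8 / 6\<close>, the value of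
    \<open>sqrt (x + 2) / x\<close> at \<open>x = 6\<close>, and 35/72, the largest value of
    \<open>u / x\<close> with \<open>2 * (u / x) + 1 / 36 \<le> 1\<close>.\<close>
  have "x + 2 \<le> (17 / 36 * x)\<^sup>2"
  proof -
    have "0 \<le> (x - 6) * (289 * x + 438)" using assms by simp
    then show ?thesis by (simp add: power2_eq_square algebra_simps)
  qed
  then have "u\<^sup>2 \<le> (17 / 36 * x)\<^sup>2" using assms(5) by linarith
  then have "u \<le> 17 / 36 * x" by (rule power2_le_imp_le) (use assms(1) in simp)
  then have 1: "u / x \<le> 17 / 36" using assms by (simp add: divide_le_eq)
  have 2: "(1 / x)\<^sup>2 \<le> (1 / 6)\<^sup>2" using assms by (intro power_mono divide_left_mono) auto
  have "v\<^sup>2 \<le> (u + 1 / x)\<^sup>2" using assms by (intro power_mono) auto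
  also have "\<dots> = u\<^sup>2 + 2 * (u / x) + (1 / x)\<^sup>2" by (simp add: power2_sum)
  also have "\<dots> \<le> x + 3" using 1 2 assms(5) by (simp add: power2_eq_square)
  finally show ?thesis .
qed

text \<open>One induction serves both bounds: the lower one at \<open>Suc k\<close> needs the
  quadratic one at \<open>k\<close>, and squaring the upper estimate at \<open>Suc k\<close> needs
  the lower one there.\<close>

lemma T_excess_bounds:
  assumes "1 \<le> k"
  shows "1 \<le> T k - real k \<and> (T k - real k)\<^sup>2 \<le> real k + 2"
  using assms
proof (induction k rule: dec_induct)
  case base
  have "2 \<le> exp (1::real)" using exp_ge_add_one_self[of 1] by simp
  moreover have "(exp 1 - 1)\<^sup>2 \<le> (173 / 100 :: real)\<^sup>2"
    using exp_1_le_273 by (intro power_mono) auto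
  ultimately show ?case unfolding T_1 by (simp add: power2_eq_square)
next
  case (step k)
  have ge: "1 \<le> T (Suc k) - real (Suc k)"
    using T_Suc_ge_if_excess_small[of k] step by simp
  \<comment> \<open>The step of \<open>excess_step\<close> needs \<open>k \<ge> 6\<close>; smaller \<open>k\<close> are checked numerically.\<close>
  have bound: "(T j - real j)\<^sup>2 \<le> real j + 2"
    if "1 \<le> T j - real j" "T j - real j \<le> c" "c\<^sup>2 \<le> real j + 2" for j c
    using that power_mono[of "T j - real j" c 2] by linarith
  have "(T (Suc k) - real (Suc k))\<^sup>2 \<le> real (Suc k) + 2"
  proof -
    consider "k = 1" | "k = 2" | "k = 3" | "k = 4" | "k = 5" | "6 \<le> k"
      using step.hyps by linarith
    then show ?thesis
    proof cases
      case 1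
      then have "Suc k = 2" by simp
      then show ?thesis using bound[of 2 2] ge T_2_less by (simp only:) simp
    next
      case 2
      then have "Suc k = 3" by simp
      then show ?thesis using bound[of 3 2] ge T_3_less by simp
    next
      case 3
      then have "Suc k = 4" by simp
      then show ?thesis using bound[of 4 "7/3"] ge T_small_values
        by (simp add: power2_eq_square)
    next
      case 4
      then have "Suc k = 5" by simp
      then show ?thesis using bound[of 5 "31/12"] ge T_small_values
        by (simp add: power2_eq_square)
    next
      case 5
      then have "Suc k = 6" by simp
      then show ?thesis using bound[of 6 "167/60"] ge T_small_values
        by (simp add: power2_eq_square)
    next
      case 6
      have "T (Suc k) - real (Suc k) \<le> T k - real k + 1 / real k"
        using T_Suc_le[of k] step.hyps by simp
      then have "(T (Suc k) - real (Suc k))\<^sup>2 \<le> real k + 3"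
        using 6 ge step.IH by (intro excess_step[of "real k" _ "T k - real k"]) auto
      then show ?thesis by simp
    qed
  qed
  with ge show ?case by blast
qed

lemma T_Suc_ge: "1 \<le> k \<Longrightarrow> T k + 1 \<le> T (Suc k)"
  using T_Suc_ge_if_excess_small T_excess_bounds by blast

lemma T_excess_mono:
  assumes "1 \<le> j" "j \<le> k"
  shows "T j - real j \<le> T k - real k"
  using assms(2)
proof (induction k rule: dec_induct)
  case (step k)
  then show ?case using T_Suc_ge[of k] assms(1) by simp
qed simp

lemma T_mono: "1 \<le> j \<Longrightarrow> j \<le> k \<Longrightarrow> T j \<le> T k"
  using T_excess_mono[of j k] by simp

lemma T_excess_increment:
  assumes "1 \<le> j"
  shows "T (j + d) - real (j + d) \<le> T j - real j + real d / real j"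
proof (induction d)
  case (Suc d)
  have "T (Suc (j + d)) \<le> T (j + d) + 1 + 1 / real (j + d)"
    using assms by (intro T_Suc_le) simp
  moreover have "1 / real (j + d) \<le> 1 / real j"
    using assms by (intro divide_left_mono) auto
  ultimately show ?case using Suc.IH by (simp add: add_divide_distrib)
qed simp

text \<open>Amounts to \<open>sigma n < n\<close>. Each increment of \<open>T\<close> is at most
  2.\<close>

lemma T_less_linear: "3 \<le> n \<Longrightarrow> T n < 2 * real n - 1"
proof (induction n rule: dec_induct)
  case (step n)
  have "1 / real n \<le> 1" using step.hyps by simp
  moreover have "T (Suc n) \<le> T n + 1 + 1 / real n" using step.hyps by (intro T_Suc_le) simp
  ultimately show ?case using step.IH unfolding of_nat_Suc by argo
qed (use T_3_less in simp)

text \<open>Serves to derive \<open>2 * m \<le> n\<close> in \<open>sigma_window\<close>. The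
  constant fits the base case: twice 11.1 is \<open>24 - 9 / 5\<close>.\<close>

lemma twice_T_less_linear: "8 \<le> n \<Longrightarrow> 2 * T n < 3 * real n - 9 / 5"
proof (induction n rule: dec_induct)
  case (step n)
  have "1 / real n \<le> 1 / 8" using step.hyps by simp
  moreover have "T (Suc n) \<le> T n + 1 + 1 / real n" using step.hyps by (intro T_Suc_le) simp
  ultimately show ?case using step.IH unfolding of_nat_Suc by argo
qed (use T_small_values in simp)

section \<open>The sequence \<open>sigma\<close> as the integer part of the excess, plus 1\<close>

lemma sigma_ge_iff: "l \<le> sigma k \<longleftrightarrow> real_of_int (int k + l - 1) \<le> T k"
  unfolding sigma_eq_floor by (simp add: le_floor_iff flip: le_floor_iff) linarith

lemma sigma_less_iff: "sigma k < l \<longleftrightarrow> T k < real_of_int (int k + l - 1)"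
  using sigma_ge_iff[of l k] by linarith

lemma sigma_mono:
  assumes "1 \<le> j" "j \<le> k"
  shows "sigma j \<le> sigma k"
proof -
  have "real_of_int (int j + sigma j - 1) \<le> T j" using sigma_ge_iff by blast
  then show ?thesis using T_excess_mono[OF assms] by (simp add: sigma_ge_iff)
qed

lemma sigma_ge_2: "1 \<le> k \<Longrightarrow> 2 \<le> sigma k"
  using T_excess_bounds[of k] by (simp add: sigma_ge_iff)

lemma sigma_less_self: "3 \<le> n \<Longrightarrow> sigma n < int n"
  using T_less_linear[of n] by (simp add: sigma_less_iff)

text \<open>Here \<open>j + m\<close> is the \<open>n\<close> of the theorem, so \<open>j\<close> is
  the left end of the window.\<close>

lemma sigma_window:
  assumes "1 \<le> j" and m: "sigma (j + m) = int m"
  shows "sigma (j + m) \<le> sigma j + 1"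
proof (cases "m \<le> 3")
  case True
  then show ?thesis using sigma_ge_2[OF assms(1)] m by simp
next
  case False
  let ?n = "j + m"
  have T: "real ?n + real m - 1 \<le> T ?n"
    using m sigma_ge_iff[of "int m" ?n] by simp
  \<comment> \<open>Since \<open>m \<ge> 4\<close>, the excess at \<open>?n\<close> is at least 3,
    whereas at 7 it is still at most \<open>2 + 57 / 60\<close>.\<close>
  have n8: "8 \<le> ?n"
  proof (rule ccontr)
    assume "\<not> 8 \<le> ?n"
    then have "T ?n - real ?n \<le> T 7 - real 7"
      using assms(1) T_excess_mono[of ?n 7] by simp
    then show False using T False T_small_values(4) by simp
  qed
  have "2 * real m < real ?n + 1" using T twice_T_less_linear[OF n8] unfolding of_nat_add by argo
  then have "m \<le> j" by simp
  then have "real m / real j \<le> 1" using assms(1) by simp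
  then have "T ?n - real ?n \<le> T j - real j + 1"
    using T_excess_increment[OF assms(1), of m] by linarith
  moreover have "T j < real j + real_of_int (sigma j)"
    using sigma_less_iff[of j "sigma j + 1"] by simp
  ultimately have "T ?n < real_of_int (int ?n + (sigma j + 2) - 1)" by simp
  then show ?thesis using sigma_less_iff[of ?n "sigma j + 2"] by simp
qed

section \<open>Locating \<open>n_fact a\<close> by comparing \<open>T k\<close> with
  \<open>exp 1 * a\<close>\<close>

lemma power_le_fact_iff:
  fixes a :: real
  assumes "0 < a" "1 \<le> k"
  shows "a ^ k \<le> fact k \<longleftrightarrow> exp 1 * a \<le> T k"
proof -
  have "exp 1 * a \<le> T k \<longleftrightarrow> (exp 1 * a) ^ k \<le> T k ^ k"
    using assms T_pos[of k] by (intro power_mono_iff[symmetric]) auto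
  also have "\<dots> \<longleftrightarrow> a ^ k \<le> fact k"
    using assms by (simp add: T_power power_mult_distrib)
  finally show ?thesis ..
qed

lemma n_fact_le:
  fixes a :: real
  assumes "0 < a" "1 \<le> k" "exp 1 * a \<le> T k"
  shows "n_fact a \<le> k"
  using n_fact_props(3)[of k a] power_le_fact_iff[of a k] assms by simp

text \<open>Monotonicity of \<open>T\<close> carries the failure at \<open>k\<close> down to all
  smaller indices.\<close>

lemma n_fact_gt:
  fixes a :: real
  assumes "0 < a" "1 \<le> k" "T k < exp 1 * a"
  shows "k < n_fact a"
proof (rule ccontr)
  assume "\<not> k < n_fact a"
  then have "T (n_fact a) \<le> T k"
    using T_mono n_fact_props(1)[of a] by simp
  moreover have "exp 1 * a \<le> T (n_fact a)"
    using n_fact_props(1,2)[of a] assms(1) by (simp flip: power_le_fact_iff)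
  ultimately show False using assms by simp
qed

theorem theorem3:
  fixes a :: real and n :: nat and m :: int
  assumes "a > 1"
    and "n \<ge> 3"
    and "real n / exp 1 < a" and "a \<le> (real n + 1) / exp 1"
    and "of_int (int n + m - 1) \<le> exp 1 * root n (fact n)"
    and "exp 1 * root n (fact n) < of_int (int n + m)"
  defines "V \<equiv> sigma ` {k::nat. int n - m \<le> int k \<and> k \<le> n}"
  defines "is_step \<equiv> (\<lambda>l::nat. int n - m \<le> int l \<and> l < n \<and> sigma (l + 1) = sigma l + 1)"
  shows "2 \<le> m \<and> m = sigma n \<and> m < int n \<and> (card V = 1 \<or> card V = 2)
    \<and> (card V = 2 \<longrightarrow> (\<exists>!l. is_step l))
    \<and> (card V = 1 \<or> (card V = 2 \<and> (\<exists>l. is_step l \<and> int l = int n - m))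
         \<longrightarrow> int (n_fact a) = int n - m + 1 \<or> int (n_fact a) = int n - m + 2)
    \<and> (\<forall>l. card V = 2 \<and> is_step l \<and> int l = int n - m + 1
         \<longrightarrow> int (n_fact a) = int n - m + 2)
    \<and> (\<forall>l. card V = 2 \<and> is_step l \<and> int l \<ge> int n - m + 2
         \<longrightarrow> int (n_fact a) = int n - m + 2 \<or> int (n_fact a) = int n - m + 3)"
proof -
  have m: "m = sigma n"
    using assms(5,6) sigma_eq_iff[of n m] by (simp add: T_def)
  have m2: "2 \<le> m" and mn: "m < int n"
    using sigma_ge_2[of n] sigma_less_self[of n] assms(2) m by auto
  define M where "M = nat m"
  define j where "j = n - M"
  have M: "int M = m" "2 \<le> M" using m2 by (auto simp: M_def)
  have j: "1 \<le> j" "int j = int n - m" and n: "n = j + M"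
    using M mn by (auto simp: j_def)
  have window: "{k::nat. int n - m \<le> int k \<and> k \<le> n} = {j..n}"
    using j by auto
  have top: "sigma n \<le> sigma j + 1"
    using sigma_window[of j M] j(1) m M(1) n by simp
  have mono: "sigma i \<le> sigma k" if "j \<le> i" "i \<le> k" for i k
    using sigma_mono[of i k] that j(1) by simp
  have jn: "j \<le> n" using n by simp
  have V_sub: "V \<subseteq> {m - 1, m}"
  proof
    fix s assume "s \<in> V"
    then obtain k where k: "j \<le> k" "k \<le> n" "s = sigma k"
      unfolding V_def window by auto
    then show "s \<in> {m - 1, m}"
      using mono[of j k] mono[of k n] top m by auto
  qed
  have m_V: "m \<in> V" unfolding V_def window using jn m by auto
  have V_const: "card V = 1" if "sigma j = m"
  proof -
    have "V = {m}"
    proof -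
      have "sigma k = m" if "j \<le> k" "k \<le> n" for k
        using that \<open>sigma j = m\<close> mono[of j k] mono[of k n] m by simp
      then have "V \<subseteq> {m}" unfolding V_def window by auto
      then show ?thesis using m_V by blast
    qed
    then show ?thesis by simp
  qed
  have V_two: "card V = 2" if "sigma j \<noteq> m"
  proof -
    have "sigma j \<in> V" unfolding V_def window using jn by auto
    with that V_sub have "m - 1 \<in> V" by auto
    with V_sub m_V have "V = {m - 1, m}" by auto
    then show ?thesis by simp
  qed
  have step_iff: "is_step l \<longleftrightarrow> j \<le> l \<and> l < n \<and> sigma (l + 1) = sigma l + 1" for l
    unfolding is_step_def using j(2) by auto
  \<comment> \<open>All values lie in \<open>{m - 1, m}\<close>, so a step can only go from
    \<open>m - 1\<close> to \<open>m\<close>.\<close>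
  have step_low: "sigma k = m - 1" if "is_step l" "j \<le> k" "k \<le> l" for k l
    using that mono[of j k] mono[of k l] mono[of "l + 1" n] top m unfolding step_iff by simp
  have step_high: "sigma k = m" if "is_step l" "l < k" "k \<le> n" for k l
    using that mono[of j l] mono[of "l + 1" k] mono[of k n] top m unfolding step_iff by simp
  have step_unique: "l = l'" if "is_step l" "is_step l'" for l l'
    using step_low[OF that(1), of l] step_high[OF that(1), of l'] step_low[OF that(2), of l']
      step_high[OF that(2), of l] that unfolding step_iff by (cases l l' rule: linorder_cases) auto
  have step_ex: "\<exists>l. is_step l" if "card V = 2"
  proof -
    have "sigma j \<noteq> m" using that V_const by auto
    then have low: "sigma j = m - 1" using top mono[of j n] jn m by simp
    \<comment> \<open>The last index with the lower value is the step.\<close>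
    define l where "l = (GREATEST k. j \<le> k \<and> k \<le> n \<and> sigma k = m - 1)"
    have l: "j \<le> l \<and> l \<le> n \<and> sigma l = m - 1"
      unfolding l_def by (rule GreatestI_nat[where b = n and k = j]) (use low jn in auto)
    then have ln: "l < n" using m by (cases "l = n") auto
    have "sigma (l + 1) \<noteq> m - 1"
    proof
      assume "sigma (l + 1) = m - 1"
      then have "l + 1 \<le> l" using l ln
        unfolding l_def by (intro Greatest_le_nat[where b = n]) (auto simp flip: l_def)
      then show False by simp
    qed
    then have "sigma (l + 1) = m"
      using mono[of l "l + 1"] mono[of "l + 1" n] l ln m by simp
    then show ?thesis using l ln step_iff by auto
  qed
  have a0: "0 < a" and ea: "real n < exp 1 * a" "exp 1 * a \<le> real n + 1"
    using assms(1,3,4) by (auto simp: field_simps)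
  \<comment> \<open>This and \<open>high\<close> decide every \<open>k\<close> except those with
    \<open>k + sigma k = n + 1\<close>: then \<open>T k\<close> lies in the same unit interval from
    \<open>n\<close> to \<open>n + 1\<close> as \<open>exp 1 * a\<close>. Such \<open>k\<close>
    cause the alternatives in (b) and (d).\<close>
  have low: "k < n_fact a" if "1 \<le> k" "int k + sigma k \<le> int n" for k
  proof -
    have "T k < real_of_int (int k + sigma k)"
      using sigma_less_iff[of k "sigma k + 1"] by simp
    also have "\<dots> \<le> real n" using that(2) by linarith
    finally show ?thesis using n_fact_gt[OF a0 that(1)] ea by simp
  qed
  have high: "n_fact a \<le> k" if "1 \<le> k" "int n + 2 \<le> int k + sigma k" for k
  proof -
    have "real n + 1 \<le> real_of_int (int k + sigma k - 1)" using that(2) by linarith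
    also have "\<dots> \<le> T k" using sigma_ge_iff by blast
    finally show ?thesis using n_fact_le[OF a0 that(1)] ea by simp
  qed
  have jm: "int j + m = int n" using j by simp
  have lowj: "j < n_fact a"
    using low[of j] j(1) jm mono[of j n] jn m by simp
  have b: "n_fact a \<le> j + 2" if "card V = 1 \<or> (card V = 2 \<and> (\<exists>l. is_step l \<and> int l = int n - m))"
  proof -
    \<comment> \<open>As \<open>M \<ge> 2\<close>, the index \<open>j + 2\<close> is still in the
      window.\<close>
    have "sigma (j + 2) = m"
    proof (cases "sigma j = m")
      case True
      then show ?thesis using mono[of j "j + 2"] mono[of "j + 2" n] n M m by simp
    next
      case False
      then have "is_step j" using that V_two by (auto simp flip: j(2))
      then show ?thesis using step_high[of j "j + 2"] n M by simp
    qed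
    then show ?thesis using high[of "j + 2"] jm by simp
  qed
  have c: "n_fact a = j + 2" if "is_step l" "l = j + 1" for l
  proof -
    have "sigma (j + 1) = m - 1" using step_low[of l "j + 1"] that by simp
    moreover have "sigma (j + 2) = m" using step_high[of l "j + 2"] that n M by simp
    ultimately show ?thesis using low[of "j + 1"] high[of "j + 2"] jm by simp
  qed
  have d: "n_fact a = j + 2 \<or> n_fact a = j + 3" if "is_step l" "j + 2 \<le> l" for l
  proof -
    \<comment> \<open>Now \<open>j + 1\<close> is excluded, \<open>j + 2\<close> is the undecided
      index, and \<open>j + 3\<close> suffices even if \<open>sigma (j + 3)\<close> is only
      \<open>m - 1\<close>.\<close>
    have "sigma (j + 1) = m - 1" "sigma (j + 2) = m - 1" using step_low[of l] that by auto
    moreover have "sigma (j + 2) \<le> sigma (j + 3)" using mono by simp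
    ultimately show ?thesis using low[of "j + 1"] high[of "j + 3"] jm by auto
  qed
  have card: "card V = 1 \<or> card V = 2" using V_const V_two by blast
  show ?thesis
  proof (intro conjI impI allI; (elim conjE)?)
    show "\<exists>!l. is_step l" if "card V = 2"
      using step_ex[OF that] step_unique by blast
    show "int (n_fact a) = int n - m + 1 \<or> int (n_fact a) = int n - m + 2"
      if "card V = 1 \<or> (card V = 2 \<and> (\<exists>l. is_step l \<and> int l = int n - m))"
      using b[OF that] lowj j(2) by linarith
    show "int (n_fact a) = int n - m + 2" if "is_step l" "int l = int n - m + 1" for l
      using c[OF that(1)] that(2) j(2) by linarith
    show "int (n_fact a) = int n - m + 2 \<or> int (n_fact a) = int n - m + 3"
      if "is_step l" "int n - m + 2 \<le> int l" for l
      using d[OF that(1)] that(2) j(2) by linarith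
  qed (use m m2 mn card in auto)
qed

end
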